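(* Let $\sigma$ be a permutation of $\mathbb{N}_0$. If $\liminf_{n\to\infty}8^{-n}\,\#A^\sigma_n=0$, then, for all $p\in(1,\infty)$ with $p\ne2$, the systems $(e_k)_{k\ge0}$ and $(w_{\sigma(k)})_{k\ge0}$ are not equivalent in $L_p$.
   Context: $\mathbb{N}_0=\{0,1,2,\ldots\}$ and $[m]=\{0,1,\ldots,m-1\}$; $\#A$ is the cardinality of $A$. For $n\in\mathbb{N}_0$ with binary expansion $n=\sum_{i\ge0} n_i2^i$, $n_i\in\{0,1\}$, the dyadic sum is $m\oplus n=\sum_{i\ge 0}|m_i-n_i|2^i$ (bitwise XOR). On $[0,1]$, $e_n(t)=\exp(2\pi i n t)$; $r_0,r_1,\ldots$ are the Rademacher functions ($r_i(t)=\operatorname{sign}\sin(2^{i+1}\pi t)$), and $w_n=\prod_{i\ge 0} r_i^{n_i}$ is the $n$-th Walsh function. Two systems $(a_k)_{k\ge0}$, $(b_k)_{k\ge0}$ in $L_p[0,1]$ are equivalent in $L_p$ if there is $c>0$ such that $\frac1c\|\sum_k\xi_k a_k\|_p\le\|\sum_k\xi_k b_k\|_p\le c\|\sum_k\xi_k a_k\|_p$ for all complex sequences $(\xi_k)_{k\ge0}$ with finitely many nonzero terms; $\|\cdot\|_p$ is the norm of $L_p[0,1]$. $A^\sigma_n=\{(k,l,m)\in[2^n]^3 : k+l-m\in[2^n],\ \sigma(k)\oplus\sigma(l)\oplus\sigma(m)=\sigma(k+l-m)\}$. *)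

theory Defs
  imports "HOL-Analysis.Analysis"
begin

unbundle bit_operations_syntax

definition trig :: "nat \<Rightarrow> real \<Rightarrow> complex" where
  "trig n t = exp (2 * of_real pi * \<i> * of_nat n * of_real t)"

definition rademacher :: "nat \<Rightarrow> real \<Rightarrow> real" where
  "rademacher i t = sgn (sin (2 ^ (i + 1) * pi * t))"

text \<open>The product of all \<open>r\<^sub>i\<close> to the power of the \<open>i\<close>-th binary digit of \<open>n\<close>: only the finitely
  many indices \<open>i\<close> whose digit is 1 contribute a factor.\<close>

definition walsh :: "nat \<Rightarrow> real \<Rightarrow> real" where
  "walsh n t = (\<Prod>i | bit n i. rademacher i t)"

text \<open>The norm of \<open>L\<^sub>p[0,1]\<close> for \<open>1 \<le> p < \<infinity>\<close>; it is only meaningful for functions that belong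
  to \<open>L\<^sub>p[0,1]\<close>, because the Bochner integral of a non-integrable function is 0.\<close>

definition Lp_norm :: "real \<Rightarrow> (real \<Rightarrow> complex) \<Rightarrow> real" where
  "Lp_norm p f = (LINT t:{0..1}|lborel. norm (f t) powr p) powr (1 / p)"

text \<open>Intended for systems of elements of \<open>L\<^sub>p[0,1]\<close>.\<close>

definition equivalent_in_Lp ::
    "real \<Rightarrow> (nat \<Rightarrow> real \<Rightarrow> complex) \<Rightarrow> (nat \<Rightarrow> real \<Rightarrow> complex) \<Rightarrow> bool" where
  "equivalent_in_Lp p a b \<longleftrightarrow>
     (\<exists>c>0. \<forall>\<xi>::nat \<Rightarrow> complex. finite {k. \<xi> k \<noteq> 0} \<longrightarrow>
        1 / c * Lp_norm p (\<lambda>t. \<Sum>k | \<xi> k \<noteq> 0. \<xi> k * a k t)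
          \<le> Lp_norm p (\<lambda>t. \<Sum>k | \<xi> k \<noteq> 0. \<xi> k * b k t) \<and>
        Lp_norm p (\<lambda>t. \<Sum>k | \<xi> k \<noteq> 0. \<xi> k * b k t)
          \<le> c * Lp_norm p (\<lambda>t. \<Sum>k | \<xi> k \<noteq> 0. \<xi> k * a k t))"

text \<open>The guard \<open>m \<le> k + l\<close> makes the subtraction on \<^typ>\<open>nat\<close> exact: the two conditions on
  \<open>k + l - m\<close> say that the integer \<open>k + l - m\<close> lies in \<open>{0, \<dots>, 2\<^sup>n - 1}\<close>.\<close>

definition A_set :: "(nat \<Rightarrow> nat) \<Rightarrow> nat \<Rightarrow> (nat \<times> nat \<times> nat) set" where
  "A_set \<sigma> n = {(k, l, m). k < 2 ^ n \<and> l < 2 ^ n \<and> m < 2 ^ n \<and>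
      m \<le> k + l \<and> k + l - m < 2 ^ n \<and>
      (\<sigma> k XOR \<sigma> l) XOR \<sigma> m = \<sigma> (k + l - m)}"

end

theory Submission
  imports Defs
begin

text \<open>
  The proof tests the equivalence on Dirichlet kernels. Suppose that the two systems are equivalent in
  \<open>L\<^sub>p\<close>, let \<open>N = 2\<^sup>n\<close>, and consider \<open>D(s, t) = \<Sum>\<^sub>k\<^sub><\<^sub>N e\<^sub>k(s) w\<^sub>\<sigma>\<^sub>(\<^sub>k\<^sub>)(t)\<close>. For each \<open>s\<close>, the coefficients
  \<open>e\<^sub>k(s)\<close> on the trigonometric side give a translate of the Dirichlet kernel. So the \<open>p\<close>-th
  moment of \<open>D(s, \<cdot>)\<close> is comparable, uniformly in \<open>s\<close>, to that of the Dirichlet kernel, which for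
  \<open>1 < p\<close> is of order \<open>N\<^sup>p\<^sup>-\<^sup>1\<close>.

  Two further moments of \<open>D\<close> are explicit. The second moment of \<open>D(s, \<cdot>)\<close> is \<open>N\<close> for each \<open>s\<close>, because
  the Walsh functions are orthonormal. The fourth moment, averaged over \<open>s\<close> as well, counts the
  quadruples in \<open>[N]\<close> with \<open>k + l = m + j\<close> and \<open>\<sigma>(k) \<oplus> \<sigma>(l) = \<sigma>(m) \<oplus> \<sigma>(j)\<close>, by orthogonality in
  both variables; this number is \<open>#A\<^sub>n\<close> (\<open>le_card_A_set\<close>).

  The function \<open>D(s, \<cdot>)\<close> thus has second and \<open>p\<close>-th moments of the same orders as a function of modulus \<open>N\<close> on a
  set of measure \<open>1/N\<close>. For \<open>p \<noteq> 2\<close> this forces, by interpolation, a comparably large fourth moment: at least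
  \<open>\<eta> N\<^sup>3\<close> for each \<open>s\<close>, with \<open>\<eta> > 0\<close> independent of \<open>n\<close> and \<open>s\<close> (\<open>kernel_fourth_power_ge\<close>). For \<open>p = 2\<close> the
  two moments coincide and give no such information. Averaging over \<open>s\<close> gives
  \<open>#A\<^sub>n \<ge> \<eta> 8\<^sup>n\<close> for all \<open>n\<close>, which contradicts the assumption on the lower limit.
\<close>

section \<open>Integration over a period\<close>

lemma set_integrable_bounded_Icc:
  fixes f :: "real \<Rightarrow> 'a :: {banach, second_countable_topology}"
  assumes "f \<in> borel_measurable borel" "\<And>t. norm (f t) \<le> B"
  shows "set_integrable lborel {a..b} f"
  unfolding set_integrable_def
  using assms by (intro integrableI_bounded_set_indicator[where B = B]) (auto simp: emeasure_lborel_Icc_eq)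

lemma set_integrable_sum_fun:
  fixes f :: "'i \<Rightarrow> 'b \<Rightarrow> 'a :: {banach, second_countable_topology}"
  assumes "\<And>i. i \<in> I \<Longrightarrow> set_integrable M A (f i)"
  shows "set_integrable M A (\<lambda>t. \<Sum>i\<in>I. f i t)"
  using assms unfolding set_integrable_def by (simp add: scaleR_sum_right)

lemma set_integral_sum_fun:
  fixes f :: "'i \<Rightarrow> 'b \<Rightarrow> 'a :: {banach, second_countable_topology}"
  assumes "\<And>i. i \<in> I \<Longrightarrow> set_integrable M A (f i)"
  shows "(LINT t:A|M. (\<Sum>i\<in>I. f i t)) = (\<Sum>i\<in>I. LINT t:A|M. f i t)"
  using assms unfolding set_lebesgue_integral_def set_integrable_def
  by (simp add: scaleR_sum_right)

lemma set_integral_Icc_shift: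
  fixes f :: "real \<Rightarrow> 'a :: {banach, second_countable_topology}"
  shows "(LINT t:{a..b}|lborel. f (s + t)) = (LINT t:{s + a..s + b}|lborel. f t)"
  unfolding set_lebesgue_integral_def
  by (subst (2) lborel_integral_real_affine[where c = 1 and t = s])
     (auto intro!: Bochner_Integration.integral_cong simp: indicator_def)

lemma set_integral_Icc_split:
  fixes f :: "real \<Rightarrow> 'a :: {banach, second_countable_topology}"
  assumes "a \<le> b" "b \<le> c" "set_integrable lborel {a..c} f"
  shows "(LINT t:{a..c}|lborel. f t) = (LINT t:{a..b}|lborel. f t) + (LINT t:{b..c}|lborel. f t)"
proof -
  have "AE t in lborel. \<not> (t \<in> {a..b} \<and> t \<in> {b..c})"
    using AE_lborel_singleton[of b] by eventually_elim auto
  moreover have "{a..c} = {a..b} \<union> {b..c}"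
    using assms by auto
  moreover have "set_integrable lborel {a..b} f" "set_integrable lborel {b..c} f"
    using assms by (auto intro: set_integrable_subset)
  ultimately show ?thesis
    by (simp add: set_integral_Un_AE)
qed

lemma set_integral_periodic_shift:
  fixes f :: "real \<Rightarrow> 'a :: {banach, second_countable_topology}"
  assumes f: "f \<in> borel_measurable borel" "\<And>t. norm (f t) \<le> B"
    and periodic: "\<And>t. f (1 + t) = f t" and s: "0 \<le> s" "s \<le> 1"
  shows "(LINT t:{0..1}|lborel. f (s + t)) = (LINT t:{0..1}|lborel. f t)"
proof -
  note int = set_integrable_bounded_Icc[OF f]
  have "(LINT t:{0..1}|lborel. f (s + t)) = (LINT t:{s..s + 1}|lborel. f t)"
    by (simp add: set_integral_Icc_shift)
  also have "\<dots> = (LINT t:{s..1}|lborel. f t) + (LINT t:{1..1 + s}|lborel. f t)"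
    using s set_integral_Icc_split[OF _ _ int, of s 1 "1 + s"] by (simp add: add.commute)
  also have "(LINT t:{1..1 + s}|lborel. f t) = (LINT t:{0..s}|lborel. f t)"
    using set_integral_Icc_shift[of 0 s f 1] by (simp add: periodic)
  finally show ?thesis
    using s set_integral_Icc_split[OF _ _ int, of 0 s 1] by simp
qed

text \<open>One argument for both systems: a nontrivial character changes sign under a suitable
  translation of the circle, and translations preserve the integral.\<close>

lemma set_integral_antiperiodic_eq_0:
  fixes f :: "real \<Rightarrow> 'a :: {banach, second_countable_topology}"
  assumes f: "f \<in> borel_measurable borel" "\<And>t. norm (f t) \<le> B"
    and periodic: "\<And>t. f (1 + t) = f t" and s: "0 \<le> s" "s \<le> 1"
    and antiperiodic: "\<And>t. f (s + t) = - f t"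
  shows "(LINT t:{0..1}|lborel. f t) = 0"
proof -
  have "(LINT t:{0..1}|lborel. f t) = (LINT t:{0..1}|lborel. - f t)"
    using set_integral_periodic_shift[OF f periodic s] by (simp add: antiperiodic)
  also have "\<dots> = - (LINT t:{0..1}|lborel. f t)"
    by (rule set_integral_uminus) (rule set_integrable_bounded_Icc[OF f])
  finally have "(LINT t:{0..1}|lborel. f t) + (LINT t:{0..1}|lborel. f t) = 0"
    by (metis add.left_inverse)
  hence "2 *\<^sub>R (LINT t:{0..1}|lborel. f t) = 0"
    by (simp add: scaleR_2)
  thus ?thesis by simp
qed

section \<open>Orthogonality of the two character systems\<close>

lemma trig_measurable [measurable]: "trig n \<in> borel_measurable borel"
  unfolding trig_def by (intro borel_measurable_continuous_onI continuous_intros)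

lemma norm_trig [simp]: "norm (trig n t) = 1"
  by (simp add: trig_def norm_exp_eq_Re)

lemma trig_add_arg: "trig n (s + t) = trig n s * trig n t"
  by (simp add: trig_def exp_add[symmetric] algebra_simps)

lemma trig_mult: "trig k t * trig l t = trig (k + l) t"
  by (simp add: trig_def exp_add[symmetric] algebra_simps)

lemma trig_periodic: "trig n (1 + t) = trig n t"
proof -
  have "trig n 1 = 1"
    unfolding trig_def using exp_integer_2pi[of "of_nat n"] by (simp add: mult_ac)
  thus ?thesis by (simp add: trig_add_arg)
qed

lemma trig_cnj_eq: "k \<le> l \<Longrightarrow> trig l t * cnj (trig k t) = trig (l - k) t"
  by (metis (no_types, lifting) complex_norm_square le_add_diff_inverse2 mult.assoc mult.right_neutral
        norm_trig of_real_1 power_one trig_mult)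

text \<open>The half period \<open>1/(2n)\<close> of \<open>e\<^sub>n\<close> flips its sign.\<close>

lemma integral_trig:
  assumes "n > 0" shows "(LINT t:{0..1}|lborel. trig n t) = 0"
proof (rule set_integral_antiperiodic_eq_0[where B = 1 and s = "1 / (2 * real n)"])
  have "trig n (1 / (2 * real n)) = -1"
    using assms by (simp add: trig_def field_simps)
  thus "trig n (1 / (2 * real n) + t) = - trig n t" for t
    by (simp add: trig_add_arg)
qed (use assms in \<open>simp_all add: trig_periodic\<close>)

lemma set_integral_cnj:
  "(LINT t:A|M. cnj (f t)) = cnj (LINT t:A|M. f t)"
  unfolding set_lebesgue_integral_def by (simp only: complex_cnj_scaleR[symmetric] Bochner_Integration.integral_cnj)

lemma integral_trig_orthonormal:
  "(LINT t:{0..1}|lborel. trig k t * cnj (trig l t)) = of_bool (k = l)"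
proof -
  have less: "(LINT t:{0..1}|lborel. trig j t * cnj (trig i t)) = 0" if "i < j" for i j
    using that integral_trig[of "j - i"] by (simp add: trig_cnj_eq)
  consider "k < l" | "k = l" | "l < k" by linarith
  thus ?thesis
  proof cases
    case 1
    have "(LINT t:{0..1}|lborel. trig k t * cnj (trig l t)) =
        cnj (LINT t:{0..1}|lborel. trig l t * cnj (trig k t))"
      by (simp add: mult.commute flip: set_integral_cnj)
    with 1 show ?thesis by (simp add: less)
  next
    case 2
    thus ?thesis by (simp add: trig_cnj_eq) (simp add: trig_def set_integral_const set_lebesgue_integral_def)
  qed (simp add: less)
qed

lemma rademacher_measurable [measurable]: "rademacher i \<in> borel_measurable borel"
  unfolding rademacher_def by measurable

lemma walsh_measurable [measurable]: "walsh n \<in> borel_measurable borel"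
  unfolding walsh_def by measurable

lemma abs_walsh_le_1: "\<bar>walsh n t\<bar> \<le> 1"
  unfolding walsh_def abs_prod by (intro prod_le_1) (auto simp: rademacher_def abs_sgn_eq)

lemma bit_nat_less: "bit (n :: nat) i \<Longrightarrow> i < n"
  by (metis bit_nat_def div_less even_zero leI le_less_trans less_exp)

lemma finite_bits: "finite {i. bit (n :: nat) i}"
  by (rule finite_subset[of _ "{..<n}"]) (auto dest: bit_nat_less)

lemma walsh_0 [simp]: "walsh 0 t = 1"
  by (simp add: walsh_def)

text \<open>The translation by \<open>2\<^sup>-\<^sup>j\<^sup>-\<^sup>1\<close> is half a period of \<open>r\<^sub>j\<close> and a multiple of the period of every
  faster Rademacher function; slower ones transform in no simple way.\<close>

lemma rademacher_shift:
  assumes "j \<le> i"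
  shows "rademacher i (1 / 2 ^ Suc j + t) = (if i = j then - rademacher i t else rademacher i t)"
proof -
  obtain d where d: "i = j + d" using assms le_Suc_ex by blast
  have eq: "(2::real) ^ (i + 1) * pi * (1 / 2 ^ Suc j + t) = 2 ^ (i + 1) * pi * t + of_nat (2 ^ d) * pi"
    by (simp add: d power_add field_simps)
  have "sin (2 ^ (i + 1) * pi * (1 / 2 ^ Suc j + t)) =
      (if i = j then -1 else 1) * sin (2 ^ (i + 1) * pi * t)"
    unfolding eq sin_add by (cases "d = 0") (simp_all only: sin_npi cos_npi d, simp_all)
  thus ?thesis by (simp add: rademacher_def sgn_minus)
qed

lemma rademacher_periodic: "rademacher i (1 + t) = rademacher i t"
proof -
  have eq: "(2::real) ^ (i + 1) * pi * (1 + t) = 2 ^ (i + 1) * pi * t + of_nat (2 ^ (i + 1)) * pi"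
    by (simp add: field_simps)
  show ?thesis
    unfolding rademacher_def eq sin_add by (simp only: sin_npi cos_npi) simp
qed

lemma walsh_periodic: "walsh n (1 + t) = walsh n t"
  by (simp add: walsh_def rademacher_periodic)

lemma integral_walsh: "(LINT t:{0..1}|lborel. walsh n t) = of_bool (n = 0)"
proof (cases "n = 0")
  case True
  thus ?thesis by (simp add: set_lebesgue_integral_def)
next
  case False
  \<comment> \<open>The slowest factor of \<open>w\<^sub>n\<close> sets the translation, so that all other factors are invariant.\<close>
  define j where "j = (LEAST i. bit n i)"
  have "\<exists>i. bit n i"
    using False by (metis bit_eq_iff bit_0_eq bot_apply bot_bool_def)
  hence j: "bit n j" "\<And>i. bit n i \<Longrightarrow> j \<le> i"
    unfolding j_def by (auto intro: LeastI_ex Least_le)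
  have "walsh n (1 / 2 ^ Suc j + t) = - walsh n t" for t
  proof -
    have "walsh n (1 / 2 ^ Suc j + t) = (\<Prod>i | bit n i. (if i = j then - 1 else 1) * rademacher i t)"
      unfolding walsh_def using j(2) by (intro prod.cong) (auto simp: rademacher_shift simp del: power_Suc)
    also have "\<dots> = (\<Prod>i | bit n i. if i = j then - 1 else 1) * walsh n t"
      by (simp only: prod.distrib walsh_def)
    also have "(\<Prod>i | bit n i. if i = j then - 1 else 1) = (-1 :: real)"
      using j(1) finite_bits[of n] by (simp add: prod.delta)
    finally show ?thesis by simp
  qed
  moreover have "1 / 2 ^ Suc j \<le> (1 :: real)"
    using one_le_power[of "2 :: real" "Suc j"] by (simp add: divide_le_eq_1 del: power_Suc)
  ultimately have "(LINT t:{0..1}|lborel. walsh n t) = 0"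
    using abs_walsh_le_1
    by (intro set_integral_antiperiodic_eq_0[where B = 1 and s = "1 / 2 ^ Suc j"])
       (auto simp: walsh_periodic simp del: power_Suc)
  with False show ?thesis by simp
qed

lemma AE_rademacher_square: "AE t in lborel. \<forall>i. rademacher i t * rademacher i t = 1"
proof -
  have "AE t in lborel. rademacher i t * rademacher i t = 1" for i
  proof -
    have "rademacher i t * rademacher i t = 1"
      if "t \<notin> range (\<lambda>z :: int. of_int z / 2 ^ (i + 1))" for t
    proof -
      have "sin (2 ^ (i + 1) * pi * t) \<noteq> 0"
      proof
        assume "sin (2 ^ (i + 1) * pi * t) = 0"
        then obtain z :: int where "2 ^ (i + 1) * pi * t = of_int z * pi"
          unfolding sin_zero_iff_int2 by blast
        hence "t = of_int z / 2 ^ (i + 1)" by (simp add: field_simps)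
        with that show False by blast
      qed
      thus ?thesis by (simp add: rademacher_def sgn_if)
    qed
    moreover have "AE t in lborel. t \<notin> range (\<lambda>z :: int. of_int z / 2 ^ (i + 1))"
      by (intro AE_not_in countable_imp_null_set_lborel) auto
    ultimately show ?thesis by (auto elim: eventually_mono)
  qed
  thus ?thesis by (simp add: AE_all_countable)
qed

text \<open>This fails at dyadic rationals, where Rademacher functions vanish: there \<open>w\<^sub>a w\<^sub>a\<close> can be \<open>0\<close>,
  whereas \<open>w\<^sub>0 = 1\<close>.\<close>

lemma AE_walsh_mult: "AE t in lborel. \<forall>a b. walsh a t * walsh b t = walsh (a XOR b) t"
  using AE_rademacher_square
proof eventually_elim
  case (elim t)
  have extend: "walsh c t = (\<Prod>i<K. if bit c i then rademacher i t else 1)"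
    if "{i. bit c i} \<subseteq> {..<K}" for c K
    unfolding walsh_def using that
    by (simp add: prod.If_cases Int_absorb1 flip: Collect_conj_eq)
  show ?case
  proof (intro allI)
    fix a b :: nat
    \<comment> \<open>A common range of digits, on which the three products can be compared factor by factor.\<close>
    define K where "K = max a (max b (a XOR b))"
    have "walsh c t = (\<Prod>i<K. if bit c i then rademacher i t else 1)" if "c \<in> {a, b, a XOR b}" for c
    proof (rule extend)
      show "{i. bit c i} \<subseteq> {..<K}"
        using that by (force dest: bit_nat_less simp: K_def less_max_iff_disj)
    qed
    thus "walsh a t * walsh b t = walsh (a XOR b) t"
      by (auto simp: bit_xor_iff elim simp flip: prod.distrib intro!: prod.cong)
  qed
qed

lemma xor_nat_eq_0_iff: "(a :: nat) XOR b = 0 \<longleftrightarrow> a = b"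
  by (metis xor.assoc xor.left_neutral xor.right_neutral xor_self_eq)

section \<open>Second and fourth moments of the mixed kernel\<close>

text \<open>Parseval's identity, for a family in which the same Walsh function may occur repeatedly: the
  coincidences \<open>g x = g y\<close> survive. Taking the pairs \<open>(k, l)\<close> as indices and
  \<open>g (k, l) = \<sigma>(k) \<oplus> \<sigma>(l)\<close> turns it into a formula for fourth moments.\<close>

lemma integral_norm_square_walsh_sum:
  assumes "finite P"
  shows "complex_of_real (LINT t:{0..1}|lborel. (cmod (\<Sum>x\<in>P. a x * of_real (walsh (g x) t)))\<^sup>2) =
    (\<Sum>x\<in>P. \<Sum>y\<in>P. a x * cnj (a y) * of_bool (g x = g y))"
proof -
  have int: "set_integrable lborel {0..1} (\<lambda>t. c * complex_of_real (walsh n t))" for c n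
    by (rule set_integrable_bounded_Icc[where B = "cmod c"])
       (auto simp: norm_mult intro!: mult_left_le abs_walsh_le_1)
  have "complex_of_real (LINT t:{0..1}|lborel. (cmod (\<Sum>x\<in>P. a x * of_real (walsh (g x) t)))\<^sup>2) =
    (LINT t:{0..1}|lborel. complex_of_real ((cmod (\<Sum>x\<in>P. a x * of_real (walsh (g x) t)))\<^sup>2))"
    by (rule set_integral_complex_of_real[symmetric])
  also have "\<dots> = (LINT t:{0..1}|lborel.
      (\<Sum>x\<in>P. \<Sum>y\<in>P. a x * cnj (a y) * of_real (walsh (g x XOR g y) t)))"
  proof (rule set_lebesgue_integral_cong_AE)
    show "AE t\<in>{0..1} in lborel.
        complex_of_real ((cmod (\<Sum>x\<in>P. a x * of_real (walsh (g x) t)))\<^sup>2) =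
        (\<Sum>x\<in>P. \<Sum>y\<in>P. a x * cnj (a y) * of_real (walsh (g x XOR g y) t))"
      using AE_walsh_mult
    proof eventually_elim
      case (elim t)
      have "complex_of_real ((cmod (\<Sum>x\<in>P. a x * of_real (walsh (g x) t)))\<^sup>2) =
          (\<Sum>x\<in>P. \<Sum>y\<in>P. a x * of_real (walsh (g x) t) * (cnj (a y) * of_real (walsh (g y) t)))"
        by (simp only: complex_norm_square cnj_sum complex_cnj_mult complex_cnj_complex_of_real sum_product)
      also have "\<dots> = (\<Sum>x\<in>P. \<Sum>y\<in>P. a x * cnj (a y) * of_real (walsh (g x XOR g y) t))"
        by (intro sum.cong refl) (simp add: elim[rule_format, symmetric])
      finally show ?case by simp
    qed
  qed measurable
  also have "\<dots> = (\<Sum>x\<in>P. \<Sum>y\<in>P. a x * cnj (a y) * of_bool (g x = g y))"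
  proof -
    have "set_integrable lborel {0..1} (\<lambda>t. \<Sum>y\<in>P. a x * cnj (a y) * of_real (walsh (g x XOR g y) t))" for x
      by (intro set_integrable_sum_fun int)
    moreover have "(LINT t:{0..1}|lborel. complex_of_real (walsh n t)) = of_bool (n = 0)" for n
      using integral_walsh[of n] by (simp add: set_integral_complex_of_real)
    ultimately show ?thesis
      by (simp add: set_integral_sum_fun int xor_nat_eq_0_iff)
  qed
  finally show ?thesis .
qed

text \<open>For fixed \<open>s\<close>, the correspondence \<open>e\<^sub>k \<mapsto> w\<^sub>\<sigma>\<^sub>(\<^sub>k\<^sub>)\<close> sends the translate by \<open>s\<close> of the Dirichlet kernel
  to this function of \<open>t\<close>.\<close>

definition trig_walsh_kernel :: "(nat \<Rightarrow> nat) \<Rightarrow> nat \<Rightarrow> real \<Rightarrow> real \<Rightarrow> complex" where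
  "trig_walsh_kernel \<sigma> N s t = (\<Sum>k<N. trig k s * of_real (walsh (\<sigma> k) t))"

lemma trig_walsh_kernel_measurable [measurable]: "trig_walsh_kernel \<sigma> N s \<in> borel_measurable borel"
  unfolding trig_walsh_kernel_def by measurable

lemma norm_trig_walsh_kernel_le: "cmod (trig_walsh_kernel \<sigma> N s t) \<le> real N"
proof -
  have "cmod (trig_walsh_kernel \<sigma> N s t) \<le> (\<Sum>k<N. 1)"
    unfolding trig_walsh_kernel_def
    by (intro sum_norm_le) (auto simp: norm_mult abs_walsh_le_1)
  thus ?thesis by simp
qed

lemma integral_kernel_square:
  assumes "inj \<sigma>"
  shows "(LINT t:{0..1}|lborel. (cmod (trig_walsh_kernel \<sigma> N s t))\<^sup>2) = real N"
proof -
  have "complex_of_real (LINT t:{0..1}|lborel. (cmod (trig_walsh_kernel \<sigma> N s t))\<^sup>2) =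
      (\<Sum>k<N. \<Sum>l<N. trig k s * cnj (trig l s) * of_bool (\<sigma> k = \<sigma> l))"
    unfolding trig_walsh_kernel_def by (rule integral_norm_square_walsh_sum) simp
  also have "\<dots> = (\<Sum>k<N. \<Sum>l<N. if l = k then 1 else 0)"
    using assms by (intro sum.cong refl) (auto simp: inj_eq trig_cnj_eq, simp add: trig_def)
  also have "\<dots> = of_real (real N)"
    by simp
  finally show ?thesis by (simp only: of_real_eq_iff)
qed

text \<open>The square of the kernel is again a Walsh sum, indexed by pairs.\<close>

lemma integral_kernel_fourth_power:
  "complex_of_real (LINT t:{0..1}|lborel. cmod (trig_walsh_kernel \<sigma> N s t) ^ 4) =
    (\<Sum>(k, l)\<in>{..<N} \<times> {..<N}. \<Sum>(m, j)\<in>{..<N} \<times> {..<N}.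
      trig (k + l) s * cnj (trig (m + j) s) * of_bool (\<sigma> k XOR \<sigma> l = \<sigma> m XOR \<sigma> j))"
proof -
  let ?P = "{..<N} \<times> {..<N}"
  define a where "a = (\<lambda>x :: nat \<times> nat. trig (fst x + snd x) s)"
  define g where "g = (\<lambda>x. \<sigma> (fst x) XOR \<sigma> (snd x))"
  have "(LINT t:{0..1}|lborel. cmod (trig_walsh_kernel \<sigma> N s t) ^ 4) =
      (LINT t:{0..1}|lborel. (cmod (\<Sum>x\<in>?P. a x * of_real (walsh (g x) t)))\<^sup>2)"
  proof (rule set_lebesgue_integral_cong_AE)
    show "AE t\<in>{0..1} in lborel. cmod (trig_walsh_kernel \<sigma> N s t) ^ 4 =
        (cmod (\<Sum>x\<in>?P. a x * of_real (walsh (g x) t)))\<^sup>2"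
      using AE_walsh_mult
    proof eventually_elim
      case (elim t)
      have "(trig_walsh_kernel \<sigma> N s t)\<^sup>2 = (\<Sum>k<N. \<Sum>l<N.
          (trig k s * of_real (walsh (\<sigma> k) t)) * (trig l s * of_real (walsh (\<sigma> l) t)))"
        unfolding trig_walsh_kernel_def power2_eq_square sum_product ..
      also have "\<dots> = (\<Sum>k<N. \<Sum>l<N. trig (k + l) s * of_real (walsh (\<sigma> k XOR \<sigma> l) t))"
        by (intro sum.cong refl) (simp add: elim[rule_format, symmetric] trig_mult[symmetric])
      also have "\<dots> = (\<Sum>x\<in>?P. a x * of_real (walsh (g x) t))"
        by (simp add: sum.cartesian_product a_def g_def case_prod_unfold)
      finally have "(trig_walsh_kernel \<sigma> N s t)\<^sup>2 = (\<Sum>x\<in>?P. a x * of_real (walsh (g x) t))" .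
      moreover have "cmod z ^ 4 = (cmod (z\<^sup>2))\<^sup>2" for z
        by (simp add: norm_power flip: power_mult)
      ultimately show ?case by simp
    qed
  qed measurable
  thus ?thesis
    by (simp add: integral_norm_square_walsh_sum a_def g_def case_prod_unfold)
qed

text \<open>The fourth coordinate \<open>j = k + l - m\<close> puts the conditions on sums and on XORs in the same
  symmetric form, the form in which they arise from orthogonality.\<close>

lemma card_A_set_eq:
  "card (A_set \<sigma> n) = card {((k, l), (m, j)). k < 2 ^ n \<and> l < 2 ^ n \<and> m < 2 ^ n \<and> j < 2 ^ n \<and>
      k + l = m + j \<and> \<sigma> k XOR \<sigma> l = \<sigma> m XOR \<sigma> j}" (is "_ = card ?Q")
proof (rule bij_betw_same_card)
  have xor: "(a XOR b) XOR c = d \<longleftrightarrow> a XOR b = c XOR d" for a b c d :: nat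
    by (metis xor.assoc xor.commute xor.right_neutral xor_self_eq)
  show "bij_betw (\<lambda>(k, l, m). ((k, l), (m, k + l - m))) (A_set \<sigma> n) ?Q"
    by (rule bij_betw_byWitness[where f' = "\<lambda>((k, l), (m, j)). (k, l, m)"])
       (auto simp: A_set_def xor)
qed

text \<open>Averaging the fourth moments over \<open>s\<close> leaves, by orthogonality of the trigonometric system, the
  terms with \<open>k + l = m + j\<close>; so the average is exactly the number of quadruples, and a lower bound
  uniform in \<open>s\<close> is a lower bound for it.\<close>

lemma le_card_A_set:
  assumes "\<And>s. 0 \<le> s \<Longrightarrow> s \<le> 1 \<Longrightarrow> K \<le> (LINT t:{0..1}|lborel. cmod (trig_walsh_kernel \<sigma> (2 ^ n) s t) ^ 4)"
  shows "K \<le> real (card (A_set \<sigma> n))"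
proof -
  let ?P = "{..<2 ^ n} \<times> {..<2 ^ n} :: (nat \<times> nat) set"
  define F where "F = (\<lambda>s. LINT t:{0..1}|lborel. cmod (trig_walsh_kernel \<sigma> (2 ^ n) s t) ^ 4)"
  define h where "h = (\<lambda>x :: nat \<times> nat. fst x + snd x)"
  define g where "g = (\<lambda>x. \<sigma> (fst x) XOR \<sigma> (snd x))"
  have F: "complex_of_real (F s) =
      (\<Sum>x\<in>?P. \<Sum>y\<in>?P. trig (h x) s * cnj (trig (h y) s) * of_bool (g x = g y))" for s
    unfolding F_def integral_kernel_fourth_power by (simp add: h_def g_def case_prod_unfold)
  have int: "set_integrable lborel {0..1} (\<lambda>s. trig i s * cnj (trig j s) * c)" for i j c
    unfolding trig_def by (intro borel_integrable_atLeastAtMost' continuous_intros)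
  have "set_integrable lborel {0..1} (\<lambda>s. complex_of_real (F s))"
    unfolding F by (intro set_integrable_sum_fun int)
  hence int_F: "set_integrable lborel {0..1} F"
    unfolding set_integrable_def
    by (simp add: complex_of_real_integrable_eq scaleR_conv_of_real flip: of_real_mult)
  have "complex_of_real (LINT s:{0..1}|lborel. F s) =
      (\<Sum>x\<in>?P. \<Sum>y\<in>?P. of_bool (h x = h y) * of_bool (g x = g y))"
  proof -
    have "complex_of_real (LINT s:{0..1}|lborel. F s) =
        (\<Sum>x\<in>?P. \<Sum>y\<in>?P. LINT s:{0..1}|lborel. trig (h x) s * cnj (trig (h y) s) * of_bool (g x = g y))"
      unfolding set_integral_complex_of_real[symmetric] F
      by (subst set_integral_sum_fun, intro set_integrable_sum_fun int,
          intro sum.cong refl set_integral_sum_fun int)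
    thus ?thesis by (simp only: set_integral_mult_left integral_trig_orthonormal)
  qed
  also have "\<dots> = (\<Sum>z\<in>?P \<times> ?P. of_bool (h (fst z) = h (snd z) \<and> g (fst z) = g (snd z)))"
    by (simp only: sum.cartesian_product case_prod_unfold of_bool_conj)
  also have "\<dots> = of_nat (card {z \<in> ?P \<times> ?P. h (fst z) = h (snd z) \<and> g (fst z) = g (snd z)})"
    by (simp add: of_bool_def sum.If_cases Int_def flip: sum.inter_filter)
  also have "{z \<in> ?P \<times> ?P. h (fst z) = h (snd z) \<and> g (fst z) = g (snd z)} =
      {((k, l), (m, j)). k < 2 ^ n \<and> l < 2 ^ n \<and> m < 2 ^ n \<and> j < 2 ^ n \<and>
      k + l = m + j \<and> \<sigma> k XOR \<sigma> l = \<sigma> m XOR \<sigma> j}"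
    by (auto simp: h_def g_def)
  also have "complex_of_nat (card \<dots>) = of_real (real (card (A_set \<sigma> n)))"
    by (simp only: card_A_set_eq of_real_of_nat_eq)
  finally have "(LINT s:{0..1}|lborel. F s) = real (card (A_set \<sigma> n))"
    by (simp only: of_real_eq_iff)
  moreover have "(LINT s:{0..1::real}|lborel. K) \<le> (LINT s:{0..1}|lborel. F s)"
    by (intro set_integral_mono int_F) (use assms in \<open>auto simp: F_def set_integrable_bounded_Icc[where B = "\<bar>K\<bar>"]\<close>)
  ultimately show ?thesis
    by (simp add: set_lebesgue_integral_def)
qed

section \<open>The size of the Dirichlet kernel\<close>

definition dirichlet :: "nat \<Rightarrow> real \<Rightarrow> complex" where
  "dirichlet N t = (\<Sum>k<N. trig k t)"

lemma dirichlet_measurable [measurable]: "dirichlet N \<in> borel_measurable borel"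
  unfolding dirichlet_def by measurable

lemma dirichlet_periodic: "dirichlet N (1 + t) = dirichlet N t"
  by (simp add: dirichlet_def trig_periodic)

lemma norm_dirichlet_le: "cmod (dirichlet N t) \<le> real N"
proof -
  have "cmod (dirichlet N t) \<le> (\<Sum>k<N. 1)"
    unfolding dirichlet_def by (intro sum_norm_le) auto
  thus ?thesis by simp
qed

lemma norm_dirichlet_reflect: "cmod (dirichlet N (1 - t)) = cmod (dirichlet N t)"
proof -
  have "trig k (1 - t) = cnj (trig k t)" for k
    using trig_periodic[of k "- t"] by (simp add: trig_def exp_cnj)
  hence "dirichlet N (1 - t) = cnj (dirichlet N t)"
    by (simp add: dirichlet_def)
  thus ?thesis by simp
qed

text \<open>For such small \<open>t\<close> all the summands lie within the angle \<open>\<pi>/3\<close> of \<open>1\<close>, so they cannot cancel.\<close>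

lemma norm_dirichlet_ge:
  assumes "N > 0" "0 \<le> t" "t \<le> 1 / (6 * real N)"
  shows "real N / 2 \<le> cmod (dirichlet N t)"
proof -
  have "1 / 2 \<le> Re (trig k t)" if "k < N" for k
  proof -
    have "real k * t \<le> real N * (1 / (6 * real N))"
      using that assms by (intro mult_mono) auto
    hence "2 * pi * (real k * t) \<le> 2 * pi * (1 / 6)"
      using assms by (intro mult_left_mono) auto
    hence le: "2 * pi * (real k * t) \<le> pi / 3" by simp
    have "cos (pi / 3) \<le> cos (2 * pi * (real k * t))"
      using assms le by (intro cos_monotone_0_pi_le) auto
    thus ?thesis by (simp add: trig_def Re_exp cos_60 mult_ac)
  qed
  hence "(\<Sum>k<N. 1 / 2) \<le> Re (dirichlet N t)"
    unfolding dirichlet_def Re_sum by (intro sum_mono) auto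
  also have "\<dots> \<le> cmod (dirichlet N t)" by (rule complex_Re_le_cmod)
  finally show ?thesis by simp
qed

lemma integral_norm_dirichlet_powr_ge:
  assumes "N > 0" "p > 0"
  shows "(1 / 2) powr p / 6 * real N powr (p - 1) \<le> (LINT t:{0..1}|lborel. cmod (dirichlet N t) powr p)"
proof -
  have le1: "1 / (6 * real N) \<le> 1"
    using assms by (simp add: field_simps)
  have "(1 / 2) powr p / 6 * real N powr (p - 1) = (real N / 2) powr p / (6 * real N)"
    using assms by (simp add: powr_diff powr_divide)
  also have "\<dots> = (LINT t:{0..1 / (6 * real N)}|lborel. (real N / 2) powr p)"
    using assms by (simp add: set_lebesgue_integral_def)
  also have "\<dots> = (LINT t:{0..1}|lborel. indicator {0..1 / (6 * real N)} t * (real N / 2) powr p)"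
    using assms unfolding set_lebesgue_integral_def
    by (intro Bochner_Integration.integral_cong refl)
       (auto simp: indicator_def dest: order_trans[OF _ le1])
  also have "\<dots> \<le> (LINT t:{0..1}|lborel. cmod (dirichlet N t) powr p)"
  proof (rule set_integral_mono)
    show "set_integrable lborel {0..1} (\<lambda>t. cmod (dirichlet N t) powr p)"
      using assms by (intro set_integrable_bounded_Icc[where B = "real N powr p"])
        (auto intro: powr_mono2 norm_dirichlet_le)
    show "set_integrable lborel {0..1} (\<lambda>t. indicator {0..1 / (6 * real N)} t * (real N / 2) powr p)"
      by (intro set_integrable_bounded_Icc[where B = "(real N / 2) powr p"]) (auto simp: indicator_def)
  qed (use assms norm_dirichlet_ge in \<open>auto simp: indicator_def intro!: powr_mono2\<close>)
  finally show ?thesis .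
qed

text \<open>The geometric sum formula reduces this to a lower bound for \<open>|e\<^sub>1(t) - 1| = 2 |sin (\<pi> t)|\<close>.\<close>

lemma norm_dirichlet_le_inverse:
  assumes "0 < t" "t \<le> 1 / 2"
  shows "cmod (dirichlet N t) \<le> 1 / t"
proof -
  have geom: "(trig 1 t - 1) * dirichlet N t = trig N t - 1"
  proof -
    have "trig k t = trig 1 t ^ k" for k
      by (induction k) (simp add: trig_def, metis Suc_eq_plus1_left power_Suc trig_mult)
    hence "dirichlet N t = (\<Sum>k<N. trig 1 t ^ k)" "trig N t = trig 1 t ^ N"
      unfolding dirichlet_def by (blast intro: sum.cong, blast)
    thus ?thesis by (simp only: power_diff_1_eq)
  qed
  have "trig 1 t = exp (\<i> * of_real (2 * pi * t))"
    by (simp add: trig_def mult_ac)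
  hence "cmod (trig 1 t - 1) = 2 * \<bar>sin (pi * t)\<bar>"
    by (simp only: dist_exp_i_1) simp
  moreover have "t \<le> \<bar>sin (pi * t)\<bar>"
  proof -
    \<comment> \<open>With \<open>3 < \<pi> < 4\<close>, the cubic Taylor bound \<open>sin x \<ge> x - x\<^sup>3/6\<close> loses at most a factor \<open>3\<close>.\<close>
    have "(pi * t)\<^sup>2 \<le> 2\<^sup>2"
      using assms pi_less_4 by (intro power_mono order_trans[OF mult_mono[of pi 4 t "1 / 2"]]) auto
    hence "pi * t * (1 / 3) \<le> pi * t * (1 - (pi * t)\<^sup>2 / 6)"
      using assms by (intro mult_left_mono) auto
    also have "\<dots> \<le> sin (pi * t)"
    proof -
      have "\<bar>sin (pi * t) - pi * t\<bar> \<le> (pi * t) ^ 3 / 6"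
        using Maclaurin_sin_bound[of "pi * t" 3] assms
        by (simp add: sin_coeff_def numeral_3_eq_3 del: power_Suc)
      moreover have "pi * t * (1 - (pi * t)\<^sup>2 / 6) = pi * t - (pi * t) ^ 3 / 6"
        by (simp add: algebra_simps power2_eq_square power3_eq_cube)
      ultimately show ?thesis by linarith
    qed
    finally have "pi * t / 3 \<le> sin (pi * t)" by simp
    moreover have "3 * t \<le> pi * t"
      using assms pi_gt3 by (intro mult_right_mono) auto
    ultimately show ?thesis by linarith
  qed
  ultimately have "2 * t \<le> cmod (trig 1 t - 1)" by simp
  hence "2 * t * cmod (dirichlet N t) \<le> cmod (trig 1 t - 1) * cmod (dirichlet N t)"
    by (rule mult_right_mono) simp
  also have "\<dots> = cmod (trig N t - 1)"
    by (simp only: geom flip: norm_mult)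
  also have "\<dots> \<le> 2"
    using norm_triangle_ineq4[of "trig N t" 1] by simp
  finally show ?thesis using assms by (simp add: field_simps)
qed

lemma integral_max_powr_le:
  fixes a p :: real
  assumes "0 < a" "a \<le> 1" "p > 1"
  shows "(LINT t:{0..1}|lborel. max a t powr (- p)) \<le> p / (p - 1) * a powr (1 - p)"
proof -
  have bound: "norm (max a t powr (- p)) \<le> a powr (- p)" for t
    using assms by (auto intro!: powr_mono2')
  have "(LINT t:{0..1}|lborel. max a t powr (- p)) =
      (LINT t:{0..a}|lborel. max a t powr (- p)) + (LINT t:{a..1}|lborel. max a t powr (- p))"
    using assms by (intro set_integral_Icc_split set_integrable_bounded_Icc[OF _ bound]) auto
  also have "(LINT t:{0..a}|lborel. max a t powr (- p)) = (LINT t:{0..a}|lborel. a powr (- p))"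
    by (intro set_lebesgue_integral_cong) (auto simp: max_def)
  also have "\<dots> = a powr (1 - p)"
    using assms by (simp add: set_lebesgue_integral_def powr_mult_base)
  also have "(LINT t:{a..1}|lborel. max a t powr (- p)) = (LINT t:{a..1}|lborel. t powr (- p))"
    by (intro set_lebesgue_integral_cong) (auto simp: max_def)
  also have "\<dots> = 1 powr (1 - p) / (1 - p) - a powr (1 - p) / (1 - p)"
    unfolding set_lebesgue_integral_def
  proof (rule integral_FTC_atLeastAtMost)
    show "((\<lambda>t. t powr (1 - p) / (1 - p)) has_vector_derivative x powr - p) (at x within {a..1})"
      if "a \<le> x" "x \<le> 1" for x
      using that assms
      by (auto intro!: derivative_eq_intros simp flip: has_real_derivative_iff_has_vector_derivative)
    show "continuous_on {a..1} (\<lambda>t. t powr - p)"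
      using assms by (intro continuous_intros) auto
  qed (use assms in auto)
  finally show ?thesis
    using assms by (simp add: field_simps)
qed

text \<open>On \<open>[0, 1/2]\<close> the kernel is at most \<open>1 / max (1/N) t\<close>; the other half follows by reflection.
  The condition \<open>p > 1\<close> keeps the integral of its \<open>p\<close>-th power over \<open>t \<ge> 1/N\<close> within a constant factor of that over \<open>t \<le> 1/N\<close>.\<close>

lemma integral_norm_dirichlet_powr_le:
  assumes "N > 0" "p > 1"
  shows "(LINT t:{0..1}|lborel. cmod (dirichlet N t) powr p) \<le> 2 * (p / (p - 1)) * real N powr (p - 1)"
proof -
  \<comment> \<open>Below this point the bound \<open>N\<close> is better, above it the bound \<open>1/t\<close>; they agree at \<open>a\<close>.\<close>
  define a where "a = 1 / real N"
  have a: "0 < a" "a \<le> 1" using assms by (auto simp: a_def)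
  define g where "g = (\<lambda>t. max a t powr (- p))"
  have [measurable]: "g \<in> borel_measurable borel" unfolding g_def by measurable
  have g_le: "norm (g t) \<le> a powr (- p)" for t
    using assms a by (auto simp: g_def intro!: powr_mono2')
  have half: "cmod (dirichlet N t) powr p \<le> g t" if "0 \<le> t" "t \<le> 1 / 2" for t
  proof -
    have "cmod (dirichlet N t) \<le> 1 / max a t"
      using that norm_dirichlet_le[of N t] norm_dirichlet_le_inverse[of t N] a
      by (cases "t \<le> a") (auto simp: a_def max_def)
    hence "cmod (dirichlet N t) powr p \<le> (1 / max a t) powr p"
      using assms by (intro powr_mono2) auto
    thus ?thesis using a by (simp add: g_def powr_divide powr_minus_divide)
  qed
  have int: "set_integrable lborel {0..1} g" "set_integrable lborel {0..1} (\<lambda>t. g (1 - t))"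
    using g_le by (auto intro!: set_integrable_bounded_Icc)
  have reflect: "(LINT t:{0..1}|lborel. g (1 - t)) = (LINT t:{0..1}|lborel. g t)"
    unfolding set_lebesgue_integral_def
    by (subst (2) lborel_integral_real_affine[where c = "-1" and t = 1])
       (auto intro!: Bochner_Integration.integral_cong simp: indicator_def)
  have "(LINT t:{0..1}|lborel. cmod (dirichlet N t) powr p) \<le> (LINT t:{0..1}|lborel. g t + g (1 - t))"
  proof (rule set_integral_mono)
    show "set_integrable lborel {0..1} (\<lambda>t. cmod (dirichlet N t) powr p)"
      using assms by (intro set_integrable_bounded_Icc[where B = "real N powr p"])
        (auto intro: powr_mono2 norm_dirichlet_le)
    show "cmod (dirichlet N t) powr p \<le> g t + g (1 - t)" if "t \<in> {0..1}" for t
    proof (cases "t \<le> 1 / 2")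
      case True
      thus ?thesis using that half[of t] by (auto simp: g_def intro: add_increasing2)
    next
      case False
      thus ?thesis using that half[of "1 - t"]
        by (auto simp: g_def norm_dirichlet_reflect intro: add_increasing)
    qed
  qed (use int in auto)
  also have "\<dots> = 2 * (LINT t:{0..1}|lborel. g t)"
    using int by (simp add: reflect)
  also have "\<dots> \<le> 2 * (p / (p - 1) * a powr (1 - p))"
    unfolding g_def using integral_max_powr_le[OF a assms(2)] by simp
  also have "a powr (1 - p) = real N powr (p - 1)"
    using assms by (simp add: a_def powr_divide powr_minus_divide[symmetric] flip: powr_minus)
  finally show ?thesis by simp
qed

section \<open>From equivalence of the systems to a bound on quadruples\<close>

lemma set_integrable_kernel_powr:
  assumes "p \<ge> 0"
  shows "set_integrable lborel {0..1} (\<lambda>t. cmod (trig_walsh_kernel \<sigma> N s t) powr p)"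
  using assms by (intro set_integrable_bounded_Icc[where B = "real N powr p"])
    (auto intro: powr_mono2 norm_trig_walsh_kernel_le)

lemma set_integrable_kernel_power:
  "set_integrable lborel {0..1} (\<lambda>t. cmod (trig_walsh_kernel \<sigma> N s t) ^ q)"
  by (intro set_integrable_bounded_Icc[where B = "real N ^ q"])
    (auto intro: power_mono norm_trig_walsh_kernel_le)

text \<open>The coefficients \<open>e\<^sub>k(s)\<close> translate the Dirichlet kernel by \<open>s\<close>, which does not change its norm.
  Hence the constant does not depend on \<open>s\<close>.\<close>

lemma equivalent_in_Lp_imp_kernel:
  assumes eq: "equivalent_in_Lp p trig (\<lambda>k t. complex_of_real (walsh (\<sigma> k) t))" and p: "p > 0"
  obtains C where "C > 0"
    "\<And>N s. 0 \<le> s \<Longrightarrow> s \<le> 1 \<Longrightarrow> (LINT t:{0..1}|lborel. cmod (dirichlet N t) powr p) \<le>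
      C * (LINT t:{0..1}|lborel. cmod (trig_walsh_kernel \<sigma> N s t) powr p)"
    "\<And>N s. 0 \<le> s \<Longrightarrow> s \<le> 1 \<Longrightarrow> (LINT t:{0..1}|lborel. cmod (trig_walsh_kernel \<sigma> N s t) powr p) \<le>
      C * (LINT t:{0..1}|lborel. cmod (dirichlet N t) powr p)"
proof -
  obtain c where c: "c > 0" and
    eq: "\<And>\<xi> :: nat \<Rightarrow> complex. finite {k. \<xi> k \<noteq> 0} \<Longrightarrow>
        1 / c * Lp_norm p (\<lambda>t. \<Sum>k | \<xi> k \<noteq> 0. \<xi> k * trig k t)
          \<le> Lp_norm p (\<lambda>t. \<Sum>k | \<xi> k \<noteq> 0. \<xi> k * complex_of_real (walsh (\<sigma> k) t)) \<and>
        Lp_norm p (\<lambda>t. \<Sum>k | \<xi> k \<noteq> 0. \<xi> k * complex_of_real (walsh (\<sigma> k) t))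
          \<le> c * Lp_norm p (\<lambda>t. \<Sum>k | \<xi> k \<noteq> 0. \<xi> k * trig k t)"
    using eq unfolding equivalent_in_Lp_def by blast
  have transfer: "x \<le> c powr p * y" if "x powr (1 / p) \<le> c * y powr (1 / p)" "0 \<le> x" "0 \<le> y" for x y
  proof -
    have "(x powr (1 / p)) powr p \<le> (c * y powr (1 / p)) powr p"
      using that p by (intro powr_mono2) auto
    thus ?thesis using that p c by (simp add: powr_mult powr_powr)
  qed
  let ?I = "\<lambda>N. (LINT t:{0..1}|lborel. cmod (dirichlet N t) powr p)"
  let ?J = "\<lambda>N s. (LINT t:{0..1}|lborel. cmod (trig_walsh_kernel \<sigma> N s t) powr p)"
  have nonneg: "0 \<le> ?I N" "0 \<le> ?J N s" for N s
    by (auto simp: set_lebesgue_integral_def intro!: integral_nonneg_AE)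
  have both: "?I N \<le> c powr p * ?J N s \<and> ?J N s \<le> c powr p * ?I N" if s: "0 \<le> s" "s \<le> 1" for N s
  proof -
    define \<xi> where "\<xi> = (\<lambda>k. if k < N then trig k s else 0)"
    have "trig k s \<noteq> 0" for k by (simp add: trig_def)
    hence supp: "{k. \<xi> k \<noteq> 0} = {..<N}" by (auto simp: \<xi>_def)
    have "(\<lambda>t. \<Sum>k | \<xi> k \<noteq> 0. \<xi> k * trig k t) = (\<lambda>t. dirichlet N (s + t))"
      unfolding supp by (auto simp: \<xi>_def dirichlet_def trig_add_arg)
    moreover have "(\<lambda>t. \<Sum>k | \<xi> k \<noteq> 0. \<xi> k * complex_of_real (walsh (\<sigma> k) t)) = trig_walsh_kernel \<sigma> N s"
      unfolding supp by (auto simp: \<xi>_def trig_walsh_kernel_def)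
    moreover have "(LINT t:{0..1}|lborel. cmod (dirichlet N (s + t)) powr p) = ?I N"
      using s p by (intro set_integral_periodic_shift[where B = "real N powr p"])
        (auto simp: dirichlet_periodic intro: powr_mono2 norm_dirichlet_le)
    ultimately have "1 / c * ?I N powr (1 / p) \<le> ?J N s powr (1 / p)"
        "?J N s powr (1 / p) \<le> c * ?I N powr (1 / p)"
      using eq[of \<xi>] supp by (auto simp: Lp_norm_def)
    thus ?thesis
      using c nonneg by (auto intro!: transfer simp: field_simps)
  qed
  show ?thesis
    by (rule that[of "c powr p"]) (use both c in auto)
qed

text \<open>The next two inequalities replace the interpolation between \<open>L\<^sub>p\<close>, \<open>L\<^sub>2\<close> and \<open>L\<^sub>4\<close> by a pointwise
  statement: values up to the threshold (\<open>\<delta> M\<close> or \<open>\<mu>\<close>) are charged to the lower exponent, larger ones to the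
  fourth power. The upper bound \<open>M\<close> on \<open>x\<close> lets the first one cover \<open>p > 4\<close> too.\<close>

lemma powr_le_square_plus_fourth:
  fixes x :: real
  assumes "p > 2" "0 \<le> x" "x \<le> M" "0 < \<delta>" "0 < M"
  shows "x powr p \<le> (\<delta> * M) powr (p - 2) * x\<^sup>2 + M powr (p - 4) * \<delta> powr (- 4) * x ^ 4"
proof (cases "x \<le> \<delta> * M")
  case True
  have "x powr p = x powr (p - 2) * x\<^sup>2"
    using assms by (cases "x = 0") (auto simp: powr_diff powr_numeral)
  also have "\<dots> \<le> (\<delta> * M) powr (p - 2) * x\<^sup>2"
    using assms True by (intro mult_right_mono powr_mono2) auto
  finally show ?thesis by (rule order_trans) (intro le_add_same_cancel1[THEN iffD2] mult_nonneg_nonneg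
      powr_ge_zero zero_le_power2 zero_le_even_power, simp?)
next
  case False
  hence x: "0 < x" "\<delta> * M < x"
    using assms by (auto intro: less_le_trans[OF mult_pos_pos])
  have "x powr p = M powr p * (x / M) powr p"
    using assms by (simp add: powr_divide)
  also have "\<dots> \<le> M powr p * (x / (\<delta> * M)) powr 4"
  proof (rule mult_left_mono)
    have "(x / M) powr p \<le> 1 powr p" using assms by (intro powr_mono2) auto
    moreover have "1 powr 4 \<le> (x / (\<delta> * M)) powr 4" using x assms by (intro powr_mono2) auto
    ultimately show "(x / M) powr p \<le> (x / (\<delta> * M)) powr 4" by simp
  qed simp
  also have "\<dots> = M powr (p - 4) * \<delta> powr (- 4) * x ^ 4"
    using assms x by (simp add: powr_divide powr_mult powr_diff powr_minus_divide)
  finally show ?thesis by (rule order_trans) (intro le_add_same_cancel2[THEN iffD2] mult_nonneg_nonneg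
      powr_ge_zero zero_le_power2 zero_le_even_power, simp?)
qed

lemma square_le_powr_plus_fourth:
  fixes x :: real
  assumes "p < 2" "0 \<le> x" "0 < \<mu>"
  shows "x\<^sup>2 \<le> \<mu> powr (2 - p) * x powr p + \<mu> powr (- 2) * x ^ 4"
proof (cases "x \<le> \<mu>")
  case True
  have "x\<^sup>2 = x powr (2 - p) * x powr p"
    using assms powr_add[of x "2 - p" p] by (cases "x = 0") auto
  also have "\<dots> \<le> \<mu> powr (2 - p) * x powr p"
    using assms True by (intro mult_right_mono powr_mono2) auto
  finally show ?thesis by (rule order_trans) (intro le_add_same_cancel1[THEN iffD2] mult_nonneg_nonneg
      powr_ge_zero zero_le_power2 zero_le_even_power, simp?)
next
  case False
  have "\<mu>\<^sup>2 * x\<^sup>2 \<le> x\<^sup>2 * x\<^sup>2"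
    using assms False by (intro mult_right_mono power_mono) auto
  hence "x\<^sup>2 \<le> \<mu> powr (- 2) * x ^ 4"
    using assms by (simp add: powr_minus_divide field_simps flip: power_add)
  thus ?thesis by (rule order_trans) (intro le_add_same_cancel2[THEN iffD2] mult_nonneg_nonneg
      powr_ge_zero zero_le_power2 zero_le_even_power, simp?)
qed

text \<open>Both cases insert the exact second moment \<open>N\<close> and the size \<open>N\<^sup>p\<^sup>-\<^sup>1\<close> of the \<open>p\<close>-th moment into a
  pointwise inequality with threshold \<open>\<delta> N\<close>. All terms then scale alike in \<open>N\<close>, and \<open>\<delta>\<close> can be chosen,
  independently of \<open>N\<close>, so that the fourth moment must supply at least half of the left side. For
  \<open>p > 2\<close> the \<open>p\<close>-th moment is on the left and its lower bound is used; for \<open>p < 2\<close> the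
  second moment is on the left and the upper bound for the \<open>p\<close>-th one is used.\<close>

lemma kernel_fourth_power_ge:
  assumes eq: "equivalent_in_Lp p trig (\<lambda>k t. complex_of_real (walsh (\<sigma> k) t))"
    and p: "1 < p" "p \<noteq> 2" and \<sigma>: "inj \<sigma>"
  obtains \<eta> where "\<eta> > 0"
    "\<And>N s. N > 0 \<Longrightarrow> 0 \<le> s \<Longrightarrow> s \<le> 1 \<Longrightarrow>
      \<eta> * real N ^ 3 \<le> (LINT t:{0..1}|lborel. cmod (trig_walsh_kernel \<sigma> N s t) ^ 4)"
proof -
  from p have "p > 0" by simp
  with eq obtain C where C: "C > 0"
    "\<And>N s. 0 \<le> s \<Longrightarrow> s \<le> 1 \<Longrightarrow> (LINT t:{0..1}|lborel. cmod (dirichlet N t) powr p) \<le>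
      C * (LINT t:{0..1}|lborel. cmod (trig_walsh_kernel \<sigma> N s t) powr p)"
    "\<And>N s. 0 \<le> s \<Longrightarrow> s \<le> 1 \<Longrightarrow> (LINT t:{0..1}|lborel. cmod (trig_walsh_kernel \<sigma> N s t) powr p) \<le>
      C * (LINT t:{0..1}|lborel. cmod (dirichlet N t) powr p)"
    by (rule equivalent_in_Lp_imp_kernel) blast
  let ?J = "\<lambda>N s. (LINT t:{0..1}|lborel. cmod (trig_walsh_kernel \<sigma> N s t) powr p)"
  let ?F = "\<lambda>N s. (LINT t:{0..1}|lborel. cmod (trig_walsh_kernel \<sigma> N s t) ^ 4)"
  note int = set_integrable_kernel_power[of \<sigma>] set_integrable_kernel_powr[of p \<sigma>]
  show ?thesis
  proof (cases "p > 2")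
    case True
    define \<kappa> where "\<kappa> = (1 / 2) powr p / 6 / C"
    have "\<kappa> > 0" using C by (simp add: \<kappa>_def)
    \<comment> \<open>Then the quadratic term contributes exactly half of the lower bound \<open>\<kappa> N\<^sup>p\<^sup>-\<^sup>1\<close>.\<close>
    define \<delta> where "\<delta> = (\<kappa> / 2) powr (1 / (p - 2))"
    have \<delta>: "\<delta> > 0" "\<delta> powr (p - 2) = \<kappa> / 2"
      using \<open>\<kappa> > 0\<close> True by (auto simp: \<delta>_def powr_powr)
    have "\<kappa> / 2 * \<delta> ^ 4 * real N ^ 3 \<le> ?F N s" if N: "N > 0" and s: "0 \<le> s" "s \<le> 1" for N s
    proof -
      let ?M = "real N"
      have "\<kappa> * ?M powr (p - 1) \<le> ?J N s"
        using order_trans[OF integral_norm_dirichlet_powr_ge[OF N, of p] C(2)[OF s]] p C(1)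
        by (simp add: \<kappa>_def field_simps)
      also have "?J N s \<le> (LINT t:{0..1}|lborel. (\<delta> * ?M) powr (p - 2) * (cmod (trig_walsh_kernel \<sigma> N s t))\<^sup>2
          + ?M powr (p - 4) * \<delta> powr (- 4) * cmod (trig_walsh_kernel \<sigma> N s t) ^ 4)"
        using True p N \<delta>
        by (intro set_integral_mono set_integral_add set_integrable_mult_right int
            powr_le_square_plus_fourth norm_trig_walsh_kernel_le) auto
      also have "\<dots> = (\<delta> * ?M) powr (p - 2) * ?M + ?M powr (p - 4) * \<delta> powr (- 4) * ?F N s"
        by (subst set_integral_add(2)) (auto simp: int integral_kernel_square[OF \<sigma>])
      also have "(\<delta> * ?M) powr (p - 2) * ?M = \<kappa> / 2 * ?M powr (p - 1)"
      proof -
        have "?M powr (p - 2) * ?M = ?M powr (p - 1)"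
          using N powr_add[of ?M "p - 2" 1] by simp
        thus ?thesis using N \<delta>(1) by (simp add: powr_mult \<delta>(2) mult.assoc)
      qed
      finally have "\<kappa> / 2 * ?M powr (p - 1) \<le> ?M powr (p - 4) * \<delta> powr (- 4) * ?F N s"
        by simp
      moreover have "?M powr (p - 1) = ?M powr (p - 4) * ?M ^ 3"
        using N powr_add[of ?M "p - 4" 3] by simp
      ultimately have "?M powr (p - 4) * (\<kappa> / 2 * ?M ^ 3) \<le> ?M powr (p - 4) * (\<delta> powr (- 4) * ?F N s)"
        by (simp add: mult_ac)
      hence "\<kappa> / 2 * ?M ^ 3 \<le> \<delta> powr (- 4) * ?F N s"
        using N by simp
      thus ?thesis
        using \<delta>(1) by (simp add: powr_minus_divide field_simps)
    qed
    thus ?thesis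
      using \<open>\<kappa> > 0\<close> \<delta> by (intro that[of "\<kappa> / 2 * \<delta> ^ 4"]) auto
  next
    case False
    with p have "p < 2" by simp
    define K where "K = C * (2 * (p / (p - 1)))"
    have "K > 0" using C p by (simp add: K_def)
    \<comment> \<open>Then the term with the \<open>p\<close>-th power contributes at most half of the second moment \<open>N\<close>.\<close>
    define \<delta> where "\<delta> = (1 / (2 * K)) powr (1 / (2 - p))"
    have \<delta>: "\<delta> > 0" "\<delta> powr (2 - p) * K = 1 / 2"
      using \<open>K > 0\<close> \<open>p < 2\<close> by (auto simp: \<delta>_def powr_powr)
    have "\<delta>\<^sup>2 / 2 * real N ^ 3 \<le> ?F N s" if N: "N > 0" and s: "0 \<le> s" "s \<le> 1" for N s
    proof -
      let ?M = "real N"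
      have "?M = (LINT t:{0..1}|lborel. (cmod (trig_walsh_kernel \<sigma> N s t))\<^sup>2)"
        by (simp add: integral_kernel_square[OF \<sigma>])
      also have "\<dots> \<le> (LINT t:{0..1}|lborel. (\<delta> * ?M) powr (2 - p) * cmod (trig_walsh_kernel \<sigma> N s t) powr p
          + (\<delta> * ?M) powr (- 2) * cmod (trig_walsh_kernel \<sigma> N s t) ^ 4)"
        using \<open>p < 2\<close> p N \<delta>
        by (intro set_integral_mono set_integral_add set_integrable_mult_right int
            square_le_powr_plus_fourth) auto
      also have "\<dots> = (\<delta> * ?M) powr (2 - p) * ?J N s + (\<delta> * ?M) powr (- 2) * ?F N s"
        using p by (subst set_integral_add(2)) (auto simp: int)
      also have "(\<delta> * ?M) powr (2 - p) * ?J N s \<le> (\<delta> * ?M) powr (2 - p) * (K * ?M powr (p - 1))"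
      proof (rule mult_left_mono)
        have "C * (LINT t:{0..1}|lborel. cmod (dirichlet N t) powr p) \<le> K * ?M powr (p - 1)"
          using mult_left_mono[OF integral_norm_dirichlet_powr_le[OF N p(1)], of C] C(1)
          by (simp add: K_def mult.assoc)
        thus "?J N s \<le> K * ?M powr (p - 1)"
          using C(3)[OF s, of N] by linarith
      qed simp
      also have "(\<delta> * ?M) powr (2 - p) * (K * ?M powr (p - 1)) =
          (\<delta> powr (2 - p) * K) * (?M powr (2 - p) * ?M powr (p - 1))"
        using N \<delta>(1) by (simp add: powr_mult)
      also have "?M powr (2 - p) * ?M powr (p - 1) = ?M"
        using N powr_add[of ?M "2 - p" "p - 1"] by simp
      finally have "?M / 2 \<le> (\<delta> * ?M) powr (- 2) * ?F N s"
        using \<delta>(2) by simp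
      thus ?thesis
        using N \<delta>(1) by (simp add: powr_minus_divide field_simps power2_eq_square power3_eq_cube)
    qed
    thus ?thesis
      using \<delta> by (intro that[of "\<delta>\<^sup>2 / 2"]) auto
  qed
qed

theorem corollary4p2:
  fixes \<sigma> :: "nat \<Rightarrow> nat"
  assumes "bij \<sigma>"
    and "liminf (\<lambda>n. ereal (real (card (A_set \<sigma> n)) / 8 ^ n)) = 0"
  shows "\<forall>p::real. 1 < p \<and> p \<noteq> 2 \<longrightarrow>
    \<not> equivalent_in_Lp p trig (\<lambda>k t. complex_of_real (walsh (\<sigma> k) t))"
proof (intro allI impI notI, elim conjE)
  fix p :: real
  assume p: "1 < p" "p \<noteq> 2"
    and eq: "equivalent_in_Lp p trig (\<lambda>k t. complex_of_real (walsh (\<sigma> k) t))"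
  obtain \<eta> where \<eta>: "\<eta> > 0"
    "\<And>N s. N > 0 \<Longrightarrow> 0 \<le> s \<Longrightarrow> s \<le> 1 \<Longrightarrow>
      \<eta> * real N ^ 3 \<le> (LINT t:{0..1}|lborel. cmod (trig_walsh_kernel \<sigma> N s t) ^ 4)"
    using kernel_fourth_power_ge[OF eq p bij_is_inj[OF assms(1)]] by blast
  have "\<eta> \<le> real (card (A_set \<sigma> n)) / 8 ^ n" for n
  proof -
    have "\<eta> * real (2 ^ n) ^ 3 \<le> real (card (A_set \<sigma> n))"
      by (rule le_card_A_set) (use \<eta>(2)[of "2 ^ n"] in simp)
    moreover have "real (2 ^ n) ^ 3 = 8 ^ n"
      by (simp flip: power_mult) (simp add: power_mult mult.commute[of n])
    ultimately show ?thesis by (simp add: field_simps)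
  qed
  hence "ereal \<eta> \<le> liminf (\<lambda>n. ereal (real (card (A_set \<sigma> n)) / 8 ^ n))"
    by (intro Liminf_bounded) simp
  with \<eta>(1) assms(2) show False by simp
qed

end
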